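(* A semisimple ring $R$ is a strongly $\sqrt{J}$-clean ring if and only if $R\cong\mathbb{F}_2\times\mathbb{F}_2\times\dots\times\mathbb{F}_2$ (a finite direct product of copies of $\mathbb{F}_2$).
   Context: Rings are associative with identity $1\neq 0$ (not necessarily commutative). $J(R)$ is the Jacobson radical of $R$, and $\sqrt{J(R)}=\{z\in R : z^n\in J(R)\text{ for some } n\ge 1\}$. A ring $R$ is strongly $\sqrt{J}$-clean if every $x\in R$ can be written as $x=e+z$ with $e$ an idempotent of $R$, $z\in\sqrt{J(R)}$ and $ez=ze$. Semisimple means semisimple Artinian (as in the Wedderburn–Artin theorem). $\mathbb{F}_2$ is the field with two elements. *)

theory Defs
  imports "HOL-Algebra.Algebra"
begin

text \<open>
  The library's ideals are two-sided, so one-sided ideals of a noncommutative ring are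
  introduced here, following the library's presentation of \<open>ideal\<close> and \<open>maximalideal\<close>.
  Note that \<open>ring\<close> admits the zero ring.
\<close>

locale left_ideal = additive_subgroup I R + ring R for I and R (structure) +
  assumes l_closed: "\<lbrakk>a \<in> I; x \<in> carrier R\<rbrakk> \<Longrightarrow> x \<otimes> a \<in> I"

locale maximal_left_ideal = left_ideal +
  assumes notcarr: "carrier R \<noteq> I"
    and maximal: "\<lbrakk>left_ideal J R; I \<subseteq> J; J \<subseteq> carrier R\<rbrakk> \<Longrightarrow> J = I \<or> J = carrier R"

text \<open>
  Intersecting with the carrier only matters when there is no maximal left ideal, where the
  intersection of the empty family would be the whole type.
\<close>

definition jacobson_radical :: "('a, 'b) ring_scheme \<Rightarrow> 'a set"
  where "jacobson_radical R = carrier R \<inter> \<Inter>{M. maximal_left_ideal M R}"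

definition sqrt_jacobson_radical :: "('a, 'b) ring_scheme \<Rightarrow> 'a set"
  where "sqrt_jacobson_radical R =
    {z \<in> carrier R. \<exists>n::nat. n \<ge> 1 \<and> z [^]\<^bsub>R\<^esub> n \<in> jacobson_radical R}"

definition strongly_sqrt_J_clean :: "('a, 'b) ring_scheme \<Rightarrow> bool"
  where "strongly_sqrt_J_clean R \<longleftrightarrow>
    (\<forall>x \<in> carrier R. \<exists>e \<in> carrier R. \<exists>z \<in> sqrt_jacobson_radical R.
       e \<otimes>\<^bsub>R\<^esub> e = e \<and> x = e \<oplus>\<^bsub>R\<^esub> z \<and> e \<otimes>\<^bsub>R\<^esub> z = z \<otimes>\<^bsub>R\<^esub> e)"

definition left_artinian :: "('a, 'b) ring_scheme \<Rightarrow> bool"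
  where "left_artinian R \<longleftrightarrow>
    (\<forall>I :: nat \<Rightarrow> 'a set. (\<forall>n. left_ideal (I n) R) \<and> (\<forall>n. I (Suc n) \<subseteq> I n) \<longrightarrow>
       (\<exists>N. \<forall>n \<ge> N. I n = I N))"

text \<open>
  Semisimple Artinian: descending chain condition and vanishing Jacobson radical.
  This notion is left-right symmetric.
\<close>

definition semisimple_artinian :: "('a, 'b) ring_scheme \<Rightarrow> bool"
  where "semisimple_artinian R \<longleftrightarrow> left_artinian R \<and> jacobson_radical R = {\<zero>\<^bsub>R\<^esub>}"

end

theory Submission
  imports Defs
begin

text \<open>
  Since the Jacobson radical vanishes, \<open>\<surd>J\<close> is the set of nilpotents, so the condition says that
  every element is the sum of an idempotent and a nilpotent that commute. The heart of the proof is
  that this forces \<open>R\<close> to be Boolean, which is shown by calculating with elements.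

  The obstruction to be excluded is a system of \<open>2 \<times> 2\<close> matrix units. If \<open>c\<close> and \<open>d\<close> square to
  zero and satisfy \<open>cdc = c\<close>, \<open>dcd = d\<close>, they behave like the off-diagonal matrix units and
  \<open>x = cd + c + d\<close> behaves like the matrix with rows \<open>(1, 1)\<close> and \<open>(1, 0)\<close>, for which
  \<open>x\<^sup>2 - x\<close> is the identity \<open>cd + dc\<close> of the matrix subring. But in a ring of the given kind
  every \<open>x\<^sup>2 - x\<close> is nilpotent, so this idempotent is zero and \<open>c = 0\<close>
  (\<open>strongly_nil_clean_no_matrix_units\<close>).

  Matrix units do arise from any nonzero \<open>a\<close> with \<open>a\<^sup>2 = 0\<close>: the left ideal \<open>Ra\<close> is not nil,
  because nil left ideals lie in the Jacobson radical, and a non-nilpotent element of \<open>Ra\<close>, written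
  as idempotent plus nilpotent, yields a nonzero idempotent \<open>e = ba\<close> in \<open>Ra\<close>. Hence \<open>R\<close> has no
  nonzero nilpotents (\<open>strongly_nil_clean_semiprimitive_reduced\<close>), every element equals its
  idempotent part, and \<open>R\<close> is Boolean.

  The chain condition then produces finitely many maximal ideals with zero intersection, all
  residue rings of a Boolean ring at maximal ideals have two elements, and the Chinese remainder
  theorem finishes the forward direction. Conversely a product of copies of the
  field with two elements is Boolean, so \<open>x = x + 0\<close> is a decomposition of the required form.
\<close>

section \<open>Nil left ideals and idempotents\<close>

definition strongly_nil_clean :: "('a, 'b) ring_scheme \<Rightarrow> bool"
  where "strongly_nil_clean R \<longleftrightarrow>
    (\<forall>x \<in> carrier R. \<exists>e \<in> carrier R. \<exists>z \<in> carrier R. \<exists>n::nat.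
       e \<otimes>\<^bsub>R\<^esub> e = e \<and> z [^]\<^bsub>R\<^esub> n = \<zero>\<^bsub>R\<^esub> \<and> x = e \<oplus>\<^bsub>R\<^esub> z \<and> e \<otimes>\<^bsub>R\<^esub> z = z \<otimes>\<^bsub>R\<^esub> e)"

lemma strongly_nil_cleanE:
  assumes "strongly_nil_clean R" "x \<in> carrier R"
  obtains e z n where "e \<in> carrier R" "z \<in> carrier R" "e \<otimes>\<^bsub>R\<^esub> e = e"
    "z [^]\<^bsub>R\<^esub> (n::nat) = \<zero>\<^bsub>R\<^esub>" "x = e \<oplus>\<^bsub>R\<^esub> z" "e \<otimes>\<^bsub>R\<^esub> z = z \<otimes>\<^bsub>R\<^esub> e"
  using assms unfolding strongly_nil_clean_def by blast

lemma strongly_sqrt_J_clean_imp_strongly_nil_clean: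
  assumes "jacobson_radical R = {\<zero>\<^bsub>R\<^esub>}" "strongly_sqrt_J_clean R"
  shows "strongly_nil_clean R"
  using assms unfolding strongly_nil_clean_def strongly_sqrt_J_clean_def sqrt_jacobson_radical_def
  by fastforce

context ring
begin

text \<open>
  Multiplying by the partial sums \<open>e + ew + \<dots> + ew\<^bsup>k-1\<^esup>\<close> of the geometric series turns \<open>e - w\<close> into
  \<open>e - ew\<^sup>k\<close>. With \<open>e = 1\<close> this is the invertibility of \<open>1 - w\<close>.
\<close>

lemma idempotent_minus_nilpotent_divides_idempotent:
  assumes carr: "e \<in> carrier R" "w \<in> carrier R"
    and idem: "e \<otimes> e = e" and comm: "e \<otimes> w = w \<otimes> e" and nil: "w [^] (n::nat) = \<zero>"
  shows "\<exists>s \<in> carrier R. s \<otimes> (e \<ominus> w) = e"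
proof -
  have "\<exists>s \<in> carrier R. s \<otimes> (e \<ominus> w) = e \<ominus> e \<otimes> w [^] k" for k :: nat
  proof (induction k)
    case 0
    have "\<zero> \<otimes> (e \<ominus> w) = e \<ominus> e \<otimes> w [^] (0::nat)"
      using carr by (simp add: minus_eq r_neg)
    then show ?case by blast
  next
    case (Suc k)
    then obtain s where s: "s \<in> carrier R" "s \<otimes> (e \<ominus> w) = e \<ominus> e \<otimes> w [^] k"
      by blast
    define v where "v = w [^] k"
    have v: "v \<in> carrier R" "v \<otimes> w = w [^] Suc k" using carr by (auto simp: v_def)
    have ev: "e \<otimes> v = v \<otimes> e"
      unfolding v_def using group_commutes_pow[OF comm[symmetric]] carr by metis
    have "(e \<otimes> v) \<otimes> (e \<ominus> w) = e \<otimes> v \<ominus> e \<otimes> (v \<otimes> w)"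
    proof -
      have "(e \<otimes> v) \<otimes> e = e \<otimes> v"
        using carr v idem ev by (metis m_assoc)
      then show ?thesis using carr v by (simp add: minus_eq r_distr r_minus m_assoc)
    qed
    then have "(s \<oplus> e \<otimes> v) \<otimes> (e \<ominus> w) = (e \<ominus> e \<otimes> v) \<oplus> (e \<otimes> v \<ominus> e \<otimes> (v \<otimes> w))"
      using s carr v by (simp add: l_distr v_def)
    also have "\<dots> = e \<ominus> e \<otimes> w [^] Suc k"
      using carr v(1) unfolding v(2)[symmetric] by algebra
    finally show ?case using s carr v by blast
  qed
  from this[of n] show ?thesis using nil carr by (simp add: minus_eq)
qed

lemma left_multiples_left_ideal:
  assumes a: "a \<in> carrier R"
  shows "left_ideal {r \<otimes> a | r. r \<in> carrier R} R"
proof (intro left_ideal.intro left_ideal_axioms.intro additive_subgroupI ring_axioms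
    add.subgroupI)
  show "{r \<otimes> a | r. r \<in> carrier R} \<subseteq> carrier R" using a by auto
  show "{r \<otimes> a | r. r \<in> carrier R} \<noteq> {}" by blast
  show "\<ominus> y \<in> {r \<otimes> a | r. r \<in> carrier R}" if "y \<in> {r \<otimes> a | r. r \<in> carrier R}" for y
  proof -
    obtain r where "r \<in> carrier R" "y = r \<otimes> a" using \<open>y \<in> _\<close> by blast
    then have "\<ominus> y = (\<ominus> r) \<otimes> a" "\<ominus> r \<in> carrier R" using a by (simp_all add: l_minus)
    then show ?thesis by blast
  qed
  show "y \<oplus> y' \<in> {r \<otimes> a | r. r \<in> carrier R}"
    if "y \<in> {r \<otimes> a | r. r \<in> carrier R}" "y' \<in> {r \<otimes> a | r. r \<in> carrier R}" for y y'
  proof -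
    obtain r r' where "r \<in> carrier R" "y = r \<otimes> a" "r' \<in> carrier R" "y' = r' \<otimes> a"
      using \<open>y \<in> _\<close> \<open>y' \<in> _\<close> by blast
    then have "y \<oplus> y' = (r \<oplus> r') \<otimes> a" "r \<oplus> r' \<in> carrier R" using a by (simp_all add: l_distr)
    then show ?thesis by blast
  qed
  show "x \<otimes> y \<in> {r \<otimes> a | r. r \<in> carrier R}"
    if "y \<in> {r \<otimes> a | r. r \<in> carrier R}" "x \<in> carrier R" for x y
  proof -
    obtain r where "r \<in> carrier R" "y = r \<otimes> a" using \<open>y \<in> _\<close> by blast
    then have "x \<otimes> y = (x \<otimes> r) \<otimes> a" "x \<otimes> r \<in> carrier R"
      using a \<open>x \<in> carrier R\<close> by (simp_all add: m_assoc)
    then show ?thesis by blast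
  qed
qed

lemma left_ideal_sum:
  assumes I: "left_ideal I R" and J: "left_ideal J R"
  shows "left_ideal (I <+>\<^bsub>R\<^esub> J) R"
proof (intro left_ideal.intro left_ideal_axioms.intro ring_axioms)
  show "additive_subgroup (I <+>\<^bsub>R\<^esub> J) R"
    using I J by (intro add_additive_subgroups) (auto simp: left_ideal_def)
  show "x \<otimes> y \<in> I <+>\<^bsub>R\<^esub> J" if "y \<in> I <+>\<^bsub>R\<^esub> J" and x: "x \<in> carrier R" for x y
  proof -
    from that obtain i j where ij: "i \<in> I" "j \<in> J" "y = i \<oplus> j"
      unfolding set_add_def' by auto
    moreover have "i \<in> carrier R" "j \<in> carrier R"
      using ij I J by (auto simp: left_ideal_def dest: additive_subgroup.a_Hcarr)
    ultimately have "x \<otimes> y = x \<otimes> i \<oplus> x \<otimes> j"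
      using x by (simp add: r_distr)
    then show ?thesis
      using left_ideal.l_closed[OF I ij(1) x] left_ideal.l_closed[OF J ij(2) x]
      unfolding set_add_def' by blast
  qed
qed

text \<open>
  If a maximal left ideal \<open>M\<close> missed \<open>a\<close>, then \<open>1 = m + ra\<close> with \<open>m \<in> M\<close>, and \<open>m = 1 - ra\<close> would be
  left invertible.
\<close>

lemma nil_left_multiples_imp_jacobson_radical:
  assumes a: "a \<in> carrier R"
    and nil: "\<And>r. r \<in> carrier R \<Longrightarrow> \<exists>n::nat. (r \<otimes> a) [^] n = \<zero>"
  shows "a \<in> jacobson_radical R"
proof -
  have "a \<in> M" if "maximal_left_ideal M R" for M
  proof (rule ccontr)
    assume "a \<notin> M"
    interpret M: maximal_left_ideal M R by fact
    let ?Ra = "{r \<otimes> a | r. r \<in> carrier R}"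
    let ?S = "M <+>\<^bsub>R\<^esub> ?Ra"
    have S: "left_ideal ?S R"
      using left_ideal_sum[OF M.left_ideal_axioms left_multiples_left_ideal[OF a]] .
    have sub: "?S \<subseteq> carrier R"
      using S by (auto simp: left_ideal_def dest: additive_subgroup.a_Hcarr)
    have "\<zero> \<in> ?Ra" using l_null[OF a, symmetric] zero_closed by blast
    then have "m \<oplus> \<zero> \<in> ?S" if "m \<in> M" for m using that unfolding set_add_def' by blast
    then have "m \<in> ?S" if "m \<in> M" for m using that M.a_Hcarr by simp
    then have MS: "M \<subseteq> ?S" by (rule subsetI)
    have "a \<in> ?Ra" using l_one[OF a, symmetric] one_closed by blast
    then have "\<zero> \<oplus> a \<in> ?S" using M.zero_closed unfolding set_add_def' by blast
    then have "?S \<noteq> M" using \<open>a \<notin> M\<close> a by auto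
    then have "\<one> \<in> ?S" using M.maximal[OF S MS sub] by auto
    then obtain m r where mr: "m \<in> M" "r \<in> carrier R" "\<one> = m \<oplus> r \<otimes> a"
      unfolding set_add_def' by auto
    have m: "m \<in> carrier R" using mr M.a_Hcarr by auto
    obtain n :: nat where n: "(r \<otimes> a) [^] n = \<zero>" using nil mr by blast
    obtain s where s: "s \<in> carrier R" "s \<otimes> (\<one> \<ominus> r \<otimes> a) = \<one>"
      using idempotent_minus_nilpotent_divides_idempotent[OF one_closed _ _ _ n] mr(2) a by auto
    have "\<one> \<ominus> r \<otimes> a = m"
      using mr m a by (metis a_minus_def add.inv_solve_right m_closed one_closed)
    then have "\<one> \<in> M" using s M.l_closed[OF mr(1) s(1)] by simp
    then have "x \<in> M" if "x \<in> carrier R" for x using M.l_closed[OF _ that] that by force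
    then show False using M.notcarr M.a_subset by blast
  qed
  then show ?thesis using a by (auto simp: jacobson_radical_def)
qed

section \<open>Strongly nil clean semiprimitive rings are Boolean\<close>

text \<open>
  If \<open>x = e + z\<close> is the decomposition of a non-nilpotent \<open>x\<close>, then \<open>e \<noteq> 0\<close>, and \<open>e\<close> is a left
  multiple of \<open>x\<close> because \<open>x\<close> is the idempotent \<open>e\<close> up to a commuting nilpotent.
\<close>

lemma strongly_nil_clean_idempotent_left_multiple:
  assumes clean: "strongly_nil_clean R" and J: "jacobson_radical R = {\<zero>}"
    and a: "a \<in> carrier R" "a \<noteq> \<zero>"
  shows "\<exists>b \<in> carrier R. b \<otimes> a \<noteq> \<zero> \<and> (b \<otimes> a) \<otimes> (b \<otimes> a) = b \<otimes> a"
proof -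
  obtain r where r: "r \<in> carrier R" and non_nil: "\<And>n::nat. (r \<otimes> a) [^] n \<noteq> \<zero>"
    using nil_left_multiples_imp_jacobson_radical[OF a(1)] a J by auto
  obtain e z n where e: "e \<in> carrier R" "z \<in> carrier R" "e \<otimes> e = e"
    and z: "z [^] (n::nat) = \<zero>" and x: "r \<otimes> a = e \<oplus> z" and comm: "e \<otimes> z = z \<otimes> e"
    by (rule strongly_nil_cleanE[OF clean m_closed[OF r a(1)]])
  have "e \<noteq> \<zero>" using x z e(2) non_nil by auto
  have pow: "(\<ominus> z) [^] n = (\<ominus> \<one>) [^] n \<otimes> z [^] n"
    using pow_mult_distrib[of "\<ominus> \<one>" z n] e(2) by (simp add: l_minus r_minus)
  \<comment> \<open>The sum \<open>e + z\<close> is read as a difference to fit the geometric series.\<close>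
  obtain s where s: "s \<in> carrier R" "s \<otimes> (e \<ominus> (\<ominus> z)) = e"
    using idempotent_minus_nilpotent_divides_idempotent[of e "\<ominus> z" n] e z comm pow
    by (auto simp: l_minus r_minus)
  then have "(s \<otimes> r) \<otimes> a = e"
    using x e z r a by (simp add: minus_eq m_assoc)
  then show ?thesis using \<open>e \<noteq> \<zero>\<close> e s r by (metis m_closed)
qed

text \<open>With \<open>x = e + z\<close> as in the definition, \<open>x\<^sup>2 - x = z (x + e - 1)\<close>.\<close>

lemma strongly_nil_clean_square_minus_self_nilpotent:
  assumes clean: "strongly_nil_clean R" and x: "x \<in> carrier R"
  shows "\<exists>n::nat. (x \<otimes> x \<ominus> x) [^] n = \<zero>"
proof -
  obtain e z n where e: "e \<in> carrier R" and z: "z \<in> carrier R" and idem: "e \<otimes> e = e"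
    and nil: "z [^] (n::nat) = \<zero>" and xez: "x = e \<oplus> z" and comm: "e \<otimes> z = z \<otimes> e"
    by (rule strongly_nil_cleanE[OF clean x])
  define y where "y = x \<oplus> e \<ominus> \<one>"
  have y: "y \<in> carrier R" using x e by (simp add: y_def)
  have zy: "z \<otimes> y = y \<otimes> z"
    unfolding y_def xez using e z idem comm by (simp add: ring_simprules)
  have "x \<otimes> x \<ominus> x = z \<otimes> y"
    unfolding y_def xez using e z idem comm by (simp add: ring_simprules)
  then have "(x \<otimes> x \<ominus> x) [^] n = z [^] n \<otimes> y [^] n"
    using pow_mult_distrib[OF zy z y] by simp
  then show ?thesis using nil y by auto
qed

lemma idempotent_nilpotent_zero:
  assumes "g \<in> carrier R" "g \<otimes> g = g" "g [^] (n::nat) = \<zero>"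
  shows "g = \<zero>"
proof -
  have pow: "g [^] Suc k = g" for k :: nat
    using assms(1,2) by (induction k) auto
  have "g [^] Suc n = \<zero>" using assms by simp
  then show ?thesis using pow[of n] by metis
qed

text \<open>
  The assumptions are the relations of \<open>E\<^sub>1\<^sub>2\<close> and \<open>E\<^sub>2\<^sub>1\<close>. The matrix \<open>x\<close> below has characteristic
  polynomial \<open>X\<^sup>2 - X - 1\<close>, so \<open>x\<^sup>2 - x\<close> is the identity of the matrix subring and is nilpotent only
  if that subring is zero.
\<close>

lemma strongly_nil_clean_no_matrix_units:
  assumes clean: "strongly_nil_clean R"
    and carr: "c \<in> carrier R" "d \<in> carrier R"
    and sq: "c \<otimes> c = \<zero>" "d \<otimes> d = \<zero>"
    and reg: "c \<otimes> (d \<otimes> c) = c" "d \<otimes> (c \<otimes> d) = d"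
  shows "c = \<zero>"
proof -
  have sq': "c \<otimes> (c \<otimes> t) = \<zero>" "d \<otimes> (d \<otimes> t) = \<zero>"
    and reg': "c \<otimes> (d \<otimes> (c \<otimes> t)) = c \<otimes> t" "d \<otimes> (c \<otimes> (d \<otimes> t)) = d \<otimes> t"
    if "t \<in> carrier R" for t
    using carr that sq reg by (metis m_assoc l_null m_closed)+
  define x where "x = c \<otimes> d \<oplus> c \<oplus> d"
  define g where "g = c \<otimes> d \<oplus> d \<otimes> c"
  have x: "x \<in> carrier R" and g: "g \<in> carrier R" using carr by (auto simp: x_def g_def)
  have "x \<otimes> x = g \<oplus> x"
    unfolding x_def g_def using carr by (simp add: ring_simprules sq sq' reg reg')
  then have "x \<otimes> x \<ominus> x = g"
    using x g by (simp add: minus_eq a_assoc r_neg)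
  moreover have "g \<otimes> g = g"
    unfolding g_def using carr by (simp add: ring_simprules sq sq' reg reg')
  ultimately have "g = \<zero>"
    using strongly_nil_clean_square_minus_self_nilpotent[OF clean x] idempotent_nilpotent_zero g
    by metis
  moreover have "g \<otimes> c = c"
    unfolding g_def using carr by (simp add: ring_simprules sq sq' reg reg')
  ultimately show ?thesis using carr by auto
qed

text \<open>
  Starting from an idempotent \<open>e = ba\<close>, which may be assumed to satisfy \<open>eb = b\<close>, the element
  \<open>c = ae\<close> still squares to zero (as \<open>ea = ba\<^sup>2 = 0\<close>) and \<open>b\<close> is a generalised inverse of it.
  Replacing \<open>b\<close> by \<open>d = (1 - cb)b\<close> keeps this property and makes \<open>d\<^sup>2 = 0\<close>.
\<close>

lemma strongly_nil_clean_square_zero: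
  assumes clean: "strongly_nil_clean R" and J: "jacobson_radical R = {\<zero>}"
    and a: "a \<in> carrier R" "a \<otimes> a = \<zero>"
  shows "a = \<zero>"
proof (rule ccontr)
  assume "a \<noteq> \<zero>"
  then obtain b' where b': "b' \<in> carrier R" "b' \<otimes> a \<noteq> \<zero>" "(b' \<otimes> a) \<otimes> (b' \<otimes> a) = b' \<otimes> a"
    using strongly_nil_clean_idempotent_left_multiple[OF clean J a(1)] by blast
  define e where "e = b' \<otimes> a"
  define b where "b = e \<otimes> b'"
  define c where "c = a \<otimes> e"
  define d where "d = b \<ominus> c \<otimes> (b \<otimes> b)"
  have e: "e \<in> carrier R" "e \<noteq> \<zero>" "e \<otimes> e = e" using a b' by (auto simp: e_def)
  have b: "b \<in> carrier R" using e b' by (auto simp: b_def)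
  have c: "c \<in> carrier R" using e a by (auto simp: c_def)
  have d: "d \<in> carrier R" using b c by (auto simp: d_def)
  have ba: "b \<otimes> a = e" using b' a e by (simp add: b_def m_assoc flip: e_def)
  have eb: "e \<otimes> b = b" using b' e by (simp add: b_def flip: m_assoc)
  have bc: "b \<otimes> c = e" using b a e ba by (simp add: c_def flip: m_assoc)
  have ea: "e \<otimes> a = \<zero>" using a b' by (simp add: e_def m_assoc)
  have cc: "c \<otimes> c = \<zero>" using a e ea unfolding c_def by (metis m_assoc m_closed l_null r_null)
  have ce: "c \<otimes> e = c" using a e by (simp add: c_def m_assoc)
  have bcb: "b \<otimes> (c \<otimes> b) = b" using b c bc eb by (simp flip: m_assoc)
  have cbc: "c \<otimes> (b \<otimes> c) = c" using bc ce by simp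
  have step: "c \<otimes> (c \<otimes> t) = \<zero>" "b \<otimes> (c \<otimes> (b \<otimes> t)) = b \<otimes> t" "c \<otimes> (b \<otimes> (c \<otimes> t)) = c \<otimes> t"
    if "t \<in> carrier R" for t
    using b c that cc bcb cbc by (metis m_assoc l_null m_closed)+
  have "d \<otimes> d = \<zero>" "c \<otimes> (d \<otimes> c) = c" "d \<otimes> (c \<otimes> d) = d"
    unfolding d_def using b c by (simp_all add: ring_simprules cc bcb cbc step)
  then have "c = \<zero>" using strongly_nil_clean_no_matrix_units[OF clean c d cc] by blast
  then show False using bc b e by simp
qed

text \<open>If \<open>n \<ge> 2\<close> were the nilpotency index of \<open>z\<close>, then \<open>z\<^bsup>n-1\<^esup>\<close> would square to zero.\<close>

lemma strongly_nil_clean_semiprimitive_reduced: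
  assumes clean: "strongly_nil_clean R" and J: "jacobson_radical R = {\<zero>}"
    and z: "z \<in> carrier R" "z [^] (n::nat) = \<zero>"
  shows "z = \<zero>"
  using z(2)
proof (induction n rule: less_induct)
  case (less n)
  consider "n = 0" | "n = 1" | "n \<ge> 2" by linarith
  then show ?case
  proof cases
    case 1
    then show ?thesis using less.prems z one_zeroD by auto
  next
    case 2
    then show ?thesis using less.prems z by simp
  next
    case 3
    then have "(n - 1) + (n - 1) = n + (n - 2)" by linarith
    then have "z [^] (n - 1) \<otimes> z [^] (n - 1) = z [^] n \<otimes> z [^] (n - 2)"
      by (simp only: nat_pow_mult[OF z(1)])
    also have "\<dots> = \<zero>"
      unfolding less.prems by (rule l_null[OF nat_pow_closed[OF z(1)]])
    finally have "z [^] (n - 1) = \<zero>"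
      by (rule strongly_nil_clean_square_zero[OF clean J nat_pow_closed[OF z(1)]])
    moreover have "n - 1 < n" using 3 by linarith
    ultimately show ?thesis using less.IH by blast
  qed
qed

lemma strongly_nil_clean_semiprimitive_idempotent:
  assumes clean: "strongly_nil_clean R" and J: "jacobson_radical R = {\<zero>}"
    and x: "x \<in> carrier R"
  shows "x \<otimes> x = x"
proof -
  obtain e z n where e: "e \<in> carrier R" and z: "z \<in> carrier R" and idem: "e \<otimes> e = e"
    and nil: "z [^] (n::nat) = \<zero>" and xez: "x = e \<oplus> z" and "e \<otimes> z = z \<otimes> e"
    by (rule strongly_nil_cleanE[OF clean x])
  have "z = \<zero>" using strongly_nil_clean_semiprimitive_reduced[OF clean J z nil] .
  then have "x = e" using xez e by simp
  then show ?thesis using idem by simp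
qed

end

section \<open>Boolean rings with descending chain condition\<close>

locale boolean_ring = ring +
  assumes idempotent: "x \<in> carrier R \<Longrightarrow> x \<otimes> x = x"
begin

lemma double_zero:
  assumes "x \<in> carrier R" shows "x \<oplus> x = \<zero>"
proof -
  have "(x \<oplus> x) \<otimes> (x \<oplus> x) = (x \<oplus> x) \<oplus> (x \<oplus> x)"
    unfolding l_distr[OF assms assms a_closed[OF assms assms]] r_distr[OF assms assms assms]
      idempotent[OF assms] ..
  then have "(x \<oplus> x) \<oplus> (x \<oplus> x) = x \<oplus> x" using assms idempotent by simp
  then show ?thesis using assms by (metis a_closed add.l_cancel_one)
qed

sublocale cring
proof (unfold_locales)
  fix x y assume xy: "x \<in> carrier R" "y \<in> carrier R"
  have "(x \<oplus> y) \<otimes> (x \<oplus> y) = (x \<oplus> y) \<oplus> (x \<otimes> y \<oplus> y \<otimes> x)"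
    using xy idempotent[OF xy(1)] idempotent[OF xy(2)] by (simp add: l_distr r_distr a_ac)
  then have "(x \<oplus> y) \<oplus> (x \<otimes> y \<oplus> y \<otimes> x) = x \<oplus> y"
    using xy idempotent by (metis a_closed)
  then have "x \<otimes> y \<oplus> y \<otimes> x = \<zero>"
    using add.l_cancel_one[of "x \<oplus> y" "x \<otimes> y \<oplus> y \<otimes> x"] xy by (simp only: a_closed m_closed)
  then have "x \<otimes> y \<oplus> y \<otimes> x = y \<otimes> x \<oplus> y \<otimes> x" using double_zero xy by simp
  then show "x \<otimes> y = y \<otimes> x"
    using add.right_cancel[of "y \<otimes> x" "x \<otimes> y" "y \<otimes> x"] xy by (simp only: m_closed)
qed

end

lemma (in cring) left_ideal_iff_ideal: "left_ideal I R \<longleftrightarrow> ideal I R"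
proof
  assume "left_ideal I R"
  then interpret left_ideal I R .
  show "ideal I R"
    by unfold_locales (use l_closed m_comm a_Hcarr in auto)
next
  assume "ideal I R"
  then interpret ideal I R .
  show "left_ideal I R"
    by unfold_locales (use I_l_closed in auto)
qed

lemma (in cring) maximal_left_ideal_iff_maximalideal:
  "maximal_left_ideal I R \<longleftrightarrow> maximalideal I R"
  unfolding maximal_left_ideal_def maximal_left_ideal_axioms_def maximalideal_def
    maximalideal_axioms_def left_ideal_iff_ideal ..

lemma left_artinian_imp_minimal:
  assumes art: "left_artinian R"
    and ne: "S \<noteq> {}" and S: "\<And>I. I \<in> S \<Longrightarrow> left_ideal I R"
  shows "\<exists>K \<in> S. \<forall>L \<in> S. L \<subseteq> K \<longrightarrow> L = K"
proof (rule ccontr)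
  assume contra: "\<not> ?thesis"
  have "\<exists>I. \<forall>n::nat. I n \<in> S \<and> I (Suc n) \<subset> I n"
    by (rule dependent_nat_choice) (use contra ne in blast)+
  then obtain I where I: "\<And>n::nat. I n \<in> S" "\<And>n. I (Suc n) \<subset> I n" by blast
  then obtain N where "\<forall>n \<ge> N. I n = I N"
    using art S unfolding left_artinian_def by (meson psubset_imp_subset)
  then show False using I(2)[of N] by (metis le_SucI order_refl psubset_eq)
qed

text \<open>
  A minimal finite intersection of maximal ideals lies in every maximal ideal. The carrier is
  thrown in so that the empty intersection is an ideal too.
\<close>

lemma (in cring) artinian_finite_maximal_ideals:
  assumes art: "left_artinian R" and J: "jacobson_radical R = {\<zero>}" and "\<one> \<noteq> \<zero>"
  shows "\<exists>F. finite F \<and> F \<noteq> {} \<and> (\<forall>M \<in> F. maximalideal M R) \<and> \<Inter>F = {\<zero>}"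
proof -
  define families where "families = {F. finite F \<and> (\<forall>M \<in> F. maximalideal M R)}"
  define meet where "meet F = \<Inter>(insert (carrier R) F)" for F
  have "left_ideal (meet F) R" if "F \<in> families" for F
  proof -
    have "ideal M R" if "M \<in> insert (carrier R) F" for M
      using that \<open>F \<in> families\<close> oneideal unfolding families_def maximalideal_def by auto
    then show ?thesis
      unfolding left_ideal_iff_ideal meet_def by (rule i_Intersect[OF _ insert_not_empty])
  qed
  moreover have "{} \<in> families" by (simp add: families_def)
  ultimately have "\<exists>K \<in> meet ` families. \<forall>L \<in> meet ` families. L \<subseteq> K \<longrightarrow> L = K"
    by (intro left_artinian_imp_minimal[OF art]) auto
  then have "\<exists>F \<in> families. \<forall>G \<in> families. meet G \<subseteq> meet F \<longrightarrow> meet G = meet F"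
    by (simp only: bex_simps ball_simps)
  then obtain F where fam: "F \<in> families"
    and min: "\<forall>G \<in> families. meet G \<subseteq> meet F \<longrightarrow> meet G = meet F"
    by (rule bexE)
  define K where "K = meet F"
  have F: "finite F" "\<forall>M \<in> F. maximalideal M R" "K = \<Inter>(insert (carrier R) F)"
    using fam by (simp_all add: families_def K_def meet_def)
  have "K \<subseteq> M" if "maximalideal M R" for M
  proof -
    have "meet (insert M F) = K"
      unfolding K_def using F that
      by (intro mp[OF bspec[OF min]]) (auto simp: families_def meet_def)
    then show ?thesis by (auto simp: meet_def)
  qed
  then have "K \<subseteq> jacobson_radical R"
    using F unfolding jacobson_radical_def maximal_left_ideal_iff_maximalideal by auto
  moreover have "\<zero> \<in> M" if "maximalideal M R" for M
    using that by (simp add: additive_subgroup.zero_closed ideal.axioms(1) maximalideal_def)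
  ultimately have K: "K = {\<zero>}" using J F by auto
  have "F \<noteq> {}"
    using F(3) K \<open>\<one> \<noteq> \<zero>\<close> one_closed by auto
  moreover have "M \<subseteq> carrier R" if "maximalideal M R" for M
    using that by (simp add: additive_subgroup.a_subset ideal.axioms(1) maximalideal_def)
  ultimately have "\<Inter>F = K" using F by auto
  then show ?thesis using F K \<open>F \<noteq> {}\<close> by blast
qed

lemma (in ring) distinct_maximal_ideals_comaximal:
  assumes I: "maximalideal I R" and J: "maximalideal J R" and "I \<noteq> J"
  shows "I <+>\<^bsub>R\<^esub> J = carrier R"
proof -
  interpret I: maximalideal I R by fact
  interpret J: maximalideal J R by fact
  have sum: "ideal (I <+>\<^bsub>R\<^esub> J) R" using add_ideals I.is_ideal J.is_ideal by blast
  have "i \<oplus> \<zero> \<in> I <+>\<^bsub>R\<^esub> J" if "i \<in> I" for i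
    using that J.zero_closed unfolding set_add_def' by blast
  then have IS: "I \<subseteq> I <+>\<^bsub>R\<^esub> J" using I.a_Hcarr by (metis r_zero subsetI)
  have "\<zero> \<oplus> j \<in> I <+>\<^bsub>R\<^esub> J" if "j \<in> J" for j
    using that I.zero_closed unfolding set_add_def' by blast
  then have JS: "J \<subseteq> I <+>\<^bsub>R\<^esub> J" using J.a_Hcarr by (metis l_zero subsetI)
  have "I <+>\<^bsub>R\<^esub> J \<subseteq> carrier R" using sum by (simp add: additive_subgroup.a_subset ideal.axioms(1))
  then show ?thesis
    using I.I_maximal[OF sum IS] J.I_maximal[OF I.is_ideal] JS I.I_notcarr \<open>I \<noteq> J\<close> I.a_subset
    by blast
qed

section \<open>Rings with two elements\<close>

text \<open>Cancellation rules out \<open>1 + 1 = 1\<close>, so both addition tables are forced.\<close>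

lemma two_element_rings_iso:
  assumes "ring S" "ring T"
    and S: "carrier S = {\<zero>\<^bsub>S\<^esub>, \<one>\<^bsub>S\<^esub>}" "\<one>\<^bsub>S\<^esub> \<noteq> \<zero>\<^bsub>S\<^esub>"
    and T: "carrier T = {\<zero>\<^bsub>T\<^esub>, \<one>\<^bsub>T\<^esub>}" "\<one>\<^bsub>T\<^esub> \<noteq> \<zero>\<^bsub>T\<^esub>"
  shows "S \<simeq> T"
proof -
  interpret S: ring S by fact
  interpret T: ring T by fact
  have "\<one>\<^bsub>S\<^esub> \<oplus>\<^bsub>S\<^esub> \<one>\<^bsub>S\<^esub> \<noteq> \<one>\<^bsub>S\<^esub>" "\<one>\<^bsub>T\<^esub> \<oplus>\<^bsub>T\<^esub> \<one>\<^bsub>T\<^esub> \<noteq> \<one>\<^bsub>T\<^esub>"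
    using S(2) T(2) by (metis S.add.l_cancel_one S.one_closed, metis T.add.l_cancel_one T.one_closed)
  then have "\<one>\<^bsub>S\<^esub> \<oplus>\<^bsub>S\<^esub> \<one>\<^bsub>S\<^esub> = \<zero>\<^bsub>S\<^esub>" "\<one>\<^bsub>T\<^esub> \<oplus>\<^bsub>T\<^esub> \<one>\<^bsub>T\<^esub> = \<zero>\<^bsub>T\<^esub>"
    using S.a_closed[of "\<one>\<^bsub>S\<^esub>" "\<one>\<^bsub>S\<^esub>"] T.a_closed[of "\<one>\<^bsub>T\<^esub>" "\<one>\<^bsub>T\<^esub>"] S(1) T(1) by auto
  then have "(\<lambda>x. if x = \<zero>\<^bsub>S\<^esub> then \<zero>\<^bsub>T\<^esub> else \<one>\<^bsub>T\<^esub>) \<in> ring_iso S T"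
    using S T by (intro ring_iso_memI) (auto simp: bij_betw_def inj_on_def)
  then show ?thesis unfolding is_ring_iso_def by blast
qed

text \<open>As \<open>x (x - 1) = 0\<close> lies in the prime ideal \<open>M\<close>, every \<open>x\<close> is congruent to \<open>0\<close> or \<open>1\<close>.\<close>

lemma (in boolean_ring) Quot_maximal_two_elements:
  assumes "maximalideal M R"
  shows "carrier (R Quot M) = {\<zero>\<^bsub>R Quot M\<^esub>, \<one>\<^bsub>R Quot M\<^esub>}" "\<one>\<^bsub>R Quot M\<^esub> \<noteq> \<zero>\<^bsub>R Quot M\<^esub>"
proof -
  interpret M: maximalideal M R by fact
  interpret P: primeideal M R using maximalideal_prime[OF assms] .
  have zero: "\<zero>\<^bsub>R Quot M\<^esub> = M" and one: "\<one>\<^bsub>R Quot M\<^esub> = M +> \<one>"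
    and carr: "carrier (R Quot M) = (\<Union>x \<in> carrier R. {M +> x})"
    by (auto simp: FactRing_def A_RCOSETS_def')
  have "M +> x = M \<or> M +> x = M +> \<one>" if x: "x \<in> carrier R" for x
  proof -
    have "x \<otimes> (x \<ominus> \<one>) = \<zero>"
      using x idempotent[OF x] by (simp add: minus_eq r_distr r_minus r_neg)
    then have "x \<in> M \<or> x \<ominus> \<one> \<in> M"
      using P.I_prime[of x "x \<ominus> \<one>"] x M.zero_closed by simp
    then show ?thesis
      using a_rcos_zero[OF M.is_ideal] quotient_eq_iff_same_a_r_cos[OF M.is_ideal x one_closed]
      by blast
  qed
  moreover have "M = M +> \<zero>" using M.a_subset by simp
  ultimately show "carrier (R Quot M) = {\<zero>\<^bsub>R Quot M\<^esub>, \<one>\<^bsub>R Quot M\<^esub>}"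
    unfolding zero one carr by blast
  show "\<one>\<^bsub>R Quot M\<^esub> \<noteq> \<zero>\<^bsub>R Quot M\<^esub>"
    unfolding zero one using M.rcos_const_imp_mem M.one_imp_carrier M.I_notcarr by auto
qed

lemma ZFact_2_two_elements:
  "carrier (ZFact 2) = {\<zero>\<^bsub>ZFact 2\<^esub>, \<one>\<^bsub>ZFact 2\<^esub>}" "\<one>\<^bsub>ZFact 2\<^esub> \<noteq> \<zero>\<^bsub>ZFact 2\<^esub>"
proof -
  have I: "ideal (Idl\<^bsub>\<Z>\<^esub> {2}) \<Z>" by (rule int.genideal_ideal) simp
  have zero: "\<zero>\<^bsub>ZFact 2\<^esub> = ZMod 2 0"
    using int.a_rcos_zero[OF I additive_subgroup.zero_closed[OF ideal.axioms(1)[OF I]]]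
    by (simp add: ZFact_defs ZMod_def)
  have one: "\<one>\<^bsub>ZFact 2\<^esub> = ZMod 2 1"
    by (simp add: ZFact_defs ZMod_def)
  have carr: "carrier (ZFact 2) = range (ZMod 2)"
    by (auto simp: ZFact_defs A_RCOSETS_def' ZMod_def)
  have "ZMod 2 k = ZMod 2 0 \<or> ZMod 2 k = ZMod 2 1" for k
    unfolding ZMod_eq_mod by presburger
  then show "carrier (ZFact 2) = {\<zero>\<^bsub>ZFact 2\<^esub>, \<one>\<^bsub>ZFact 2\<^esub>}"
    unfolding zero one carr by auto
  show "\<one>\<^bsub>ZFact 2\<^esub> \<noteq> \<zero>\<^bsub>ZFact 2\<^esub>"
    unfolding zero one ZMod_eq_mod by simp
qed

section \<open>Products of rings\<close>

lemma RDirProd_list_iso_cong: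
  assumes "list_all2 (\<lambda>R S. R \<simeq> S) Rs Ss"
  shows "RDirProd_list Rs \<simeq> RDirProd_list Ss"
  using assms
proof (induction rule: list_all2_induct)
  case Nil
  have "(\<lambda>_. []) \<in> ring_iso nil_ring nil_ring"
    by (intro ring_iso_memI) (auto simp: monoid.defs bij_betw_def)
  then show ?case unfolding is_ring_iso_def by auto
next
  case (Cons R Rs S Ss)
  then obtain f g where "f \<in> ring_iso R S" "g \<in> ring_iso (RDirProd_list Rs) (RDirProd_list Ss)"
    unfolding is_ring_iso_def by blast
  then have prods: "RDirProd R (RDirProd_list Rs) \<simeq> RDirProd S (RDirProd_list Ss)"
    using RDirProd_iso6 unfolding is_ring_iso_def by blast
  have "RDirProd_list (R # Rs) \<simeq> RDirProd R (RDirProd_list Rs)"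
    using RDirProd_list_iso2 unfolding is_ring_iso_def by blast
  then have "RDirProd_list (R # Rs) \<simeq> RDirProd S (RDirProd_list Ss)"
    using prods by (rule ring_iso_trans)
  moreover have "RDirProd S (RDirProd_list Ss) \<simeq> RDirProd_list (S # Ss)"
    using RDirProd_list_iso1 unfolding is_ring_iso_def by blast
  ultimately show ?case by (rule ring_iso_trans)
qed

lemma RDirProd_list_mult_Cons:
  assumes "x \<in> carrier R" "y \<in> carrier R"
    and "xs \<in> carrier (RDirProd_list Rs)" "ys \<in> carrier (RDirProd_list Rs)"
  shows "(x # xs) \<otimes>\<^bsub>RDirProd_list (R # Rs)\<^esub> (y # ys) =
    (x \<otimes>\<^bsub>R\<^esub> y) # (xs \<otimes>\<^bsub>RDirProd_list Rs\<^esub> ys)"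
  using ring_hom_mult[OF RDirProd_list_hom1[of R Rs], of "(x, xs)" "(y, ys)"] assms
  by (simp add: RDirProd_carrier) (simp add: RDirProd_def DirProd_def monoid.defs)

lemma RDirProd_list_idempotent:
  assumes "\<And>R x. R \<in> set Rs \<Longrightarrow> x \<in> carrier R \<Longrightarrow> x \<otimes>\<^bsub>R\<^esub> x = x"
    and "xs \<in> carrier (RDirProd_list Rs)"
  shows "xs \<otimes>\<^bsub>RDirProd_list Rs\<^esub> xs = xs"
  using assms
proof (induction Rs arbitrary: xs)
  case Nil
  then show ?case by (simp add: monoid.defs)
next
  case (Cons R Rs)
  then obtain y ys where "xs = y # ys" "y \<in> carrier R" "ys \<in> carrier (RDirProd_list Rs)"
    unfolding RDirProd_list_carrier by auto
  with Cons show ?case by (simp add: RDirProd_list_mult_Cons)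
qed

theorem (in boolean_ring) artinian_semiprimitive_iso_product:
  assumes "left_artinian R" "jacobson_radical R = {\<zero>}" "\<one> \<noteq> \<zero>"
  shows "\<exists>n::nat. n \<ge> 1 \<and> R \<simeq> RDirProd_list (replicate n (ZFact 2))"
proof -
  obtain F where F: "finite F" "F \<noteq> {}" "\<And>M. M \<in> F \<Longrightarrow> maximalideal M R" "\<Inter>F = {\<zero>}"
    using artinian_finite_maximal_ideals[OF assms] by blast
  \<comment> \<open>The Chinese remainder theorem is about families indexed by \<open>{..n}\<close>, hence the predecessor.\<close>
  define n where "n = card F - 1"
  have "{0..<card F} = {..n}"
    using F(1,2) card_gt_0_iff[of F] unfolding n_def by auto
  then obtain I where I: "bij_betw I {..n} F"
    using ex_bij_betw_nat_finite[OF F(1)] by metis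
  have max: "maximalideal (I i) R" if "i \<le> n" for i
    using F(3) I that unfolding bij_betw_def by blast
  have "I i <+>\<^bsub>R\<^esub> I j = carrier R" if "i \<le> n" "j \<le> n" "i \<noteq> j" for i j
    using distinct_maximal_ideals_comaximal[OF max max] I that
    unfolding bij_betw_def inj_on_def by (metis atMost_iff)
  moreover have "ideal (I i) R" if "i \<le> n" for i
    using max[OF that] by (simp add: maximalideal_def)
  ultimately have "R Quot (\<Inter>i \<le> n. I i) \<simeq> RDirProd_list (map (\<lambda>i. R Quot (I i)) [0..<Suc n])"
    by (intro chinese_remainder) auto
  moreover have "(\<Inter>i \<le> n. I i) = {\<zero>}" using F(4) I unfolding bij_betw_def by simp
  ultimately have "R \<simeq> RDirProd_list (map (\<lambda>i. R Quot (I i)) [0..<Suc n])"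
    using FactRing_zeroideal(2) ring_iso_trans by metis
  moreover have "RDirProd_list (map (\<lambda>i. R Quot (I i)) [0..<Suc n]) \<simeq>
      RDirProd_list (replicate (Suc n) (ZFact 2))"
  proof (intro RDirProd_list_iso_cong list_all2_all_nthI)
    fix k assume "k < length (map (\<lambda>i. R Quot (I i)) [0..<Suc n])"
    then have k: "k < Suc n" by simp
    then have M: "maximalideal (I k) R" using max by simp
    have "ring (R Quot (I k))"
      using M by (intro ideal.quotient_is_ring) (simp add: maximalideal_def)
    then have "R Quot (I k) \<simeq> ZFact 2"
      using cring.axioms(1)[OF ZFact_is_cring] Quot_maximal_two_elements[OF M] ZFact_2_two_elements
      by (rule two_element_rings_iso)
    then show "map (\<lambda>i. R Quot (I i)) [0..<Suc n] ! k \<simeq> replicate (Suc n) (ZFact 2) ! k"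
      using k by (simp del: upt_Suc replicate_Suc)
  qed simp
  ultimately have "R \<simeq> RDirProd_list (replicate (Suc n) (ZFact 2))"
    using ring_iso_trans by blast
  then show ?thesis by (intro exI[of _ "Suc n"]) simp
qed

section \<open>The characterisation\<close>

lemma iso_ZFact_2_product_idempotent:
  assumes "ring R" and iso: "R \<simeq> RDirProd_list (replicate n (ZFact 2))" and x: "x \<in> carrier R"
  shows "x \<otimes>\<^bsub>R\<^esub> x = x"
proof -
  interpret ring R by fact
  obtain h where h: "h \<in> ring_iso R (RDirProd_list (replicate n (ZFact 2)))" (is "h \<in> ring_iso R ?P")
    using iso unfolding is_ring_iso_def by blast
  interpret Z: cring "ZFact 2" by (rule ZFact_is_cring)
  have "y \<otimes>\<^bsub>ZFact 2\<^esub> y = y" if "y \<in> carrier (ZFact 2)" for y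
    using that ZFact_2_two_elements(1) by auto
  then have "h x \<otimes>\<^bsub>?P\<^esub> h x = h x"
    using ring_iso_memE(1)[OF h x] by (intro RDirProd_list_idempotent) auto
  then have "h (x \<otimes>\<^bsub>R\<^esub> x) = h x" using ring_iso_memE(2)[OF h x x] by simp
  then show ?thesis
    using ring_iso_memE(5)[OF h] x unfolding bij_betw_def inj_on_def by simp
qed

lemma idempotents_imp_strongly_sqrt_J_clean:
  assumes "ring R" and zero_mem: "\<zero>\<^bsub>R\<^esub> \<in> jacobson_radical R"
    and idem: "\<And>x. x \<in> carrier R \<Longrightarrow> x \<otimes>\<^bsub>R\<^esub> x = x"
  shows "strongly_sqrt_J_clean R"
proof -
  interpret ring R by fact
  have "\<zero>\<^bsub>R\<^esub> [^]\<^bsub>R\<^esub> (1::nat) \<in> jacobson_radical R" using zero_mem by simp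
  then have "\<zero>\<^bsub>R\<^esub> \<in> sqrt_jacobson_radical R"
    unfolding sqrt_jacobson_radical_def by blast
  then show ?thesis
    unfolding strongly_sqrt_J_clean_def using idem by (metis l_null r_null r_zero)
qed

theorem theorem3p8:
  fixes R :: "('a, 'b) ring_scheme" (structure)
  assumes "ring R" and "\<one> \<noteq> \<zero>" and "semisimple_artinian R"
  shows "strongly_sqrt_J_clean R \<longleftrightarrow>
    (\<exists>n::nat. n \<ge> 1 \<and> R \<simeq> RDirProd_list (replicate n (ZFact 2)))"
proof
  interpret ring R by fact
  have art: "left_artinian R" and J: "jacobson_radical R = {\<zero>}"
    using assms(3) by (auto simp: semisimple_artinian_def)
  {
    assume "strongly_sqrt_J_clean R"
    then have clean: "strongly_nil_clean R"
      by (rule strongly_sqrt_J_clean_imp_strongly_nil_clean[OF J])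
    interpret boolean_ring R
      by unfold_locales (rule strongly_nil_clean_semiprimitive_idempotent[OF clean J])
    show "\<exists>n::nat. n \<ge> 1 \<and> R \<simeq> RDirProd_list (replicate n (ZFact 2))"
      using artinian_semiprimitive_iso_product[OF art J assms(2)] .
  }
  assume "\<exists>n::nat. n \<ge> 1 \<and> R \<simeq> RDirProd_list (replicate n (ZFact 2))"
  then show "strongly_sqrt_J_clean R"
    using idempotents_imp_strongly_sqrt_J_clean[OF assms(1)] J
      iso_ZFact_2_product_idempotent[OF assms(1)] by blast
qed

end
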